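(* As $N\to\infty$, $\gamma(Q_N)\leq\frac{17}{33}N+O(1)$; that is, there is a constant $C$ such that $\gamma(Q_N)\leq\frac{17}{33}N+C$ for all positive integers $N$.
   Context: For a positive integer $N$, the queen's graph $Q_N$ is the graph whose vertices are the $N^2$ squares of the $N\times N$ chessboard, two distinct vertices being adjacent when their squares share a row, a column, or a diagonal (in either of the two diagonal directions, of any length). A dominating set of $Q_N$ is a set $D$ of squares such that every square is in $D$ or adjacent to a square of $D$. $\gamma(Q_N)$ denotes the minimum size of a dominating set of $Q_N$. *)

theory Defs
  imports Complex_Main "Graph_Theory.Pair_Digraph"
begin

text \<open>Undirected simple graphs are the symmetric loop-free digraphs of the locale
  \<^locale>\<open>pair_graph\<close>. Squares are pairs of integers so that the differences indexing one
  family of diagonals are not truncated.\<close>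

definition queen_attacks :: "int \<times> int \<Rightarrow> int \<times> int \<Rightarrow> bool" where
  "queen_attacks s t \<longleftrightarrow> s \<noteq> t \<and>
     (fst s = fst t \<or> snd s = snd t \<or>
      fst s - snd s = fst t - snd t \<or> fst s + snd s = fst t + snd t)"

definition chessboard :: "nat \<Rightarrow> (int \<times> int) set" where
  "chessboard N = {1..int N} \<times> {1..int N}"

definition queens_graph :: "nat \<Rightarrow> (int \<times> int) pair_pre_digraph" where
  "queens_graph N =
     \<lparr> pverts = chessboard N,
       parcs = {(s, t). s \<in> chessboard N \<and> t \<in> chessboard N \<and> queen_attacks s t} \<rparr>"

definition dominating_set :: "('a, 'b) pre_digraph \<Rightarrow> 'a set \<Rightarrow> bool" where
  "dominating_set G D \<longleftrightarrow> D \<subseteq> verts G \<and> (\<forall>v \<in> verts G. v \<in> D \<or> (\<exists>d \<in> D. d \<rightarrow>\<^bsub>G\<^esub> v))"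

text \<open>Finiteness is required because \<^const>\<open>card\<close> is 0 on infinite sets.\<close>

definition domination_number :: "('a, 'b) pre_digraph \<Rightarrow> nat" where
  "domination_number G = (LEAST k. \<exists>D. finite D \<and> dominating_set G D \<and> card D = k)"

lemma finite_chessboard [simp]: "finite (chessboard N)"
  by (simp add: chessboard_def)

lemma card_chessboard: "card (chessboard N) = N\<^sup>2"
  by (simp add: chessboard_def card_cartesian_product power2_eq_square)

lemma queen_attacks_sym: "queen_attacks s t \<longleftrightarrow> queen_attacks t s"
  by (auto simp: queen_attacks_def)

lemma pair_graph_queens_graph: "pair_graph (queens_graph N)"
proof
  have "parcs (queens_graph N) \<subseteq> chessboard N \<times> chessboard N"
    by (auto simp: queens_graph_def)
  then show "finite (parcs (queens_graph N))"
    by (rule finite_subset) simp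
  show "symmetric (with_proj (queens_graph N))"
    by (auto simp: symmetric_def sym_def queens_graph_def queen_attacks_sym)
qed (auto simp: queens_graph_def queen_attacks_def)

lemma dominating_set_queens_graph_iff:
  "dominating_set (with_proj (queens_graph N)) D \<longleftrightarrow>
     D \<subseteq> chessboard N \<and> (\<forall>s \<in> chessboard N. s \<in> D \<or> (\<exists>d \<in> D. queen_attacks d s))"
  by (auto simp: dominating_set_def queens_graph_def)

lemma domination_number_attained:
  assumes "finite (verts G)"
  shows "\<exists>D. finite D \<and> dominating_set G D \<and> card D = domination_number G"
  unfolding domination_number_def
proof (rule LeastI_ex)
  have "dominating_set G (verts G)"
    by (simp add: dominating_set_def)
  with assms show "\<exists>k D. finite D \<and> dominating_set G D \<and> card D = k"
    by blast
qed

lemma domination_number_le: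
  assumes "finite D" "dominating_set G D"
  shows "domination_number G \<le> card D"
  unfolding domination_number_def using assms by (intro Least_le) blast

end

theory Submission
  imports Defs
begin

text \<open>
  All but boundedly many queens stand on squares whose two coordinates are odd. If they occupy every
  odd row and every odd column, the squares left over have two even coordinates. For such a square
  half the difference and half the sum of the coordinates, measured relative to the queens, have
  opposite parity, so one of them is odd and the other even. It is therefore enough to occupy, in
  each of the two diagonal directions, the odd-numbered diagonals up to some distance \<open>\<alpha>\<close> from the
  centre and the even-numbered ones up to a distance \<open>\<beta>\<close>, where \<open>\<alpha> + \<beta>\<close> is the half-width of the
  board (\<open>queen_domination_half_board\<close>). Each of the four families then has about \<open>N / 2\<close> lines to be
  occupied, and \<open>N / 2\<close> queens would do if no line were used twice. The parallelogram law
  \<open>(X - Y)\<^sup>2 + (X + Y)\<^sup>2 = 2 X\<^sup>2 + 2 Y\<^sup>2\<close>, summed over the queens, dictates the ratio of \<open>\<alpha>\<close> and \<open>\<beta>\<close>;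
  it is irrational, so a family with a fixed pattern has to waste a little.

  The fixed pattern is a finite arrangement of blocks, cells of a coarse board, that is enlarged by a
  factor growing with \<open>N\<close>. A block of size \<open>K\<close> is the set of queens \<open>(t, 2 t mod K)\<close> for \<open>t < K\<close>, scaled
  by two. It occupies \<open>K\<close> consecutive columns, \<open>K\<close> consecutive rows and \<open>K\<close> consecutive differences
  of one parity. By the parallelogram law its sums cannot be consecutive as well: they form two
  progressions of step 3, each extending over one and a half times the size of a block. Blocks whose
  positions on the sum axis are consecutive interlock, however, since the residues modulo 3 advance
  with the position, and together they occupy all sums except for about \<open>K / 6\<close> of them at each end
  of the chain, which single queens take care of (\<open>sum_occupied\<close>, \<open>queen_domination_blow_up\<close>). So a
  coarse arrangement that covers its rows, columns and diagonals as required yields dominating sets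
  for infinitely many \<open>N\<close>.

  The coarse board used here has \<open>97 \<times> 97\<close> cells and carries 199 blocks: three in the middle and 49
  orbits under quarter turns (\<open>block_cover_seeds\<close>). With blocks of size \<open>6 m + 7\<close> this gives \<open>1198 m + O(1)\<close>
  queens on a board of side \<open>2328 m + O(1)\<close>, and \<open>1198 / 2328 < 17 / 33\<close>. Other sides are reached by adding
  one queen in the corner for each additional row and column (\<open>queen_domination_Suc\<close>).
\<close>

section \<open>Dominating sets by lines\<close>

abbreviation queen_domination :: "nat \<Rightarrow> nat" where
  "queen_domination N \<equiv> domination_number (with_proj (queens_graph N))"

lemma queen_domination_le_card:
  assumes "finite Q" "Q \<subseteq> chessboard N"
    and "\<And>x y. (x, y) \<in> chessboard N \<Longrightarrow>
           \<exists>u v. (u, v) \<in> Q \<and> (u = x \<or> v = y \<or> u - v = x - y \<or> u + v = x + y)"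
  shows "queen_domination N \<le> card Q"
proof (rule domination_number_le[OF assms(1)])
  have "s \<in> Q \<or> (\<exists>q\<in>Q. queen_attacks q s)" if "s \<in> chessboard N" for s
  proof -
    obtain x y where s: "s = (x, y)" by (cases s)
    with that assms(3) obtain u v where
      "(u, v) \<in> Q" "u = x \<or> v = y \<or> u - v = x - y \<or> u + v = x + y" by blast
    then show ?thesis
      unfolding s queen_attacks_def by (cases "(u, v) = (x, y)") (auto intro!: bexI[of _ "(u, v)"])
  qed
  with assms(2) show "dominating_set (with_proj (queens_graph N)) Q"
    unfolding dominating_set_queens_graph_iff by blast
qed

text \<open>A queen in the new corner occupies the new row and the new column.\<close>

lemma queen_domination_Suc: "queen_domination (Suc N) \<le> queen_domination N + 1"
proof -
  have "finite (verts (with_proj (queens_graph N)))"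
    by (simp add: queens_graph_def)
  then obtain D where D: "finite D" "dominating_set (with_proj (queens_graph N)) D"
      "card D = queen_domination N"
    using domination_number_attained by blast
  let ?c = "(int (Suc N), int (Suc N))"
  have dom: "D \<subseteq> chessboard N" "\<And>s. s \<in> chessboard N \<Longrightarrow> s \<in> D \<or> (\<exists>d\<in>D. queen_attacks d s)"
    using D(2) unfolding dominating_set_queens_graph_iff by blast+
  have "queen_domination (Suc N) \<le> card (insert ?c D)"
  proof (rule queen_domination_le_card)
    show "finite (insert ?c D)" using D(1) by simp
    show "insert ?c D \<subseteq> chessboard (Suc N)"
      using dom(1) by (auto simp: chessboard_def)
    fix x y assume xy: "(x, y) \<in> chessboard (Suc N)"
    show "\<exists>u v. (u, v) \<in> insert ?c D \<and> (u = x \<or> v = y \<or> u - v = x - y \<or> u + v = x + y)"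
    proof (cases "(x, y) \<in> chessboard N")
      case True
      from dom(2)[OF True] show ?thesis
        by (auto simp: queen_attacks_def) blast+
    next
      case False
      with xy have "x = int (Suc N) \<or> y = int (Suc N)"
        by (auto simp: chessboard_def)
      then show ?thesis by blast
    qed
  qed
  also have "\<dots> \<le> queen_domination N + 1"
    using D(1,3) by (metis card_insert_le_m1 Suc_eq_plus1 card_insert_if le_SucI order_refl)
  finally show ?thesis .
qed

lemma queen_domination_add: "queen_domination (N + d) \<le> queen_domination N + d"
proof (induction d)
  case (Suc d)
  then show ?case using queen_domination_Suc[of "N + d"] by simp
qed simp

section \<open>Queens on the squares with odd coordinates\<close>

text \<open>
  The pairs \<open>(X, Y)\<close> stand for the squares with odd coordinates \<open>2 (X - low) + 1\<close> and
  \<open>2 (Y - low) + 1\<close>, and \<open>(\<xi>, \<eta>)\<close> for the square with the even coordinates \<open>2 (\<xi> - low) + 2\<close> and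
  \<open>2 (\<eta> - low) + 2\<close>; this shift by one square in each direction cancels in the difference and leaves
  \<open>\<xi> + \<eta> + 1\<close> for the sum. Coverage is only demanded at distance \<open>r\<close> from the border: queens on the
  long diagonal near two corners occupy the outer \<open>2 r\<close> rows and columns on each side. This slack
  absorbs all off-by-constant effects of the construction.
\<close>

lemma queen_domination_half_board:
  fixes P :: "(int \<times> int) set" and low W r :: int
  assumes fin: "finite P" and sub: "P \<subseteq> {low..low + 2 * W} \<times> {low..low + 2 * W}"
    and r: "0 \<le> r" "r \<le> W"
    and cols: "\<And>X. low + r \<le> X \<Longrightarrow> X \<le> low + 2 * W - r \<Longrightarrow> \<exists>Y. (X, Y) \<in> P"
    and rows: "\<And>Y. low + r \<le> Y \<Longrightarrow> Y \<le> low + 2 * W - r \<Longrightarrow> \<exists>X. (X, Y) \<in> P"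
    and diags: "\<And>\<xi> \<eta>. \<xi> \<in> {low + r..low + 2 * W - r} \<Longrightarrow> \<eta> \<in> {low + r..low + 2 * W - r} \<Longrightarrow>
        \<exists>X Y. (X, Y) \<in> P \<and> (X - Y = \<xi> - \<eta> \<or> X + Y = \<xi> + \<eta> + 1)"
  shows "queen_domination (nat (4 * W + 1)) \<le> card P + nat (4 * r)"
proof -
  define border where "border = {1..2 * r} \<union> {4 * W + 2 - 2 * r..4 * W + 1}"
  define sq where "sq = (\<lambda>(X, Y). (2 * (X - low) + 1, 2 * (Y - low) + 1))"
  let ?Q = "sq ` P \<union> (\<lambda>x. (x, x)) ` border"
  have "queen_domination (nat (4 * W + 1)) \<le> card ?Q"
  proof (rule queen_domination_le_card)
    show "finite ?Q" using fin by (simp add: border_def)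
    show "?Q \<subseteq> chessboard (nat (4 * W + 1))"
      using sub r by (auto simp: chessboard_def border_def sq_def)
    fix x y assume "(x, y) \<in> chessboard (nat (4 * W + 1))"
    then have xy: "1 \<le> x" "x \<le> 4 * W + 1" "1 \<le> y" "y \<le> 4 * W + 1"
      using r by (auto simp: chessboard_def)
    show "\<exists>u v. (u, v) \<in> ?Q \<and> (u = x \<or> v = y \<or> u - v = x - y \<or> u + v = x + y)"
    proof (cases "x \<in> border \<or> y \<in> border")
      case True
      then show ?thesis by auto
    next
      case False
      have sqI: "(2 * (X - low) + 1, 2 * (Y - low) + 1) \<in> ?Q" if "(X, Y) \<in> P" for X Y
        using that by (auto simp: sq_def intro!: image_eqI[of _ _ "(X, Y)"])
      from False xy have inner: "2 * r < x" "x < 4 * W + 2 - 2 * r" "2 * r < y" "y < 4 * W + 2 - 2 * r"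
        by (auto simp: border_def)
      consider (ox) "odd x" | (oy) "odd y" | (even) "even x" "even y" by blast
      then show ?thesis
      proof cases
        case ox
        then obtain q where q: "x = 2 * q + 1" by (elim oddE)
        obtain Y where "(low + q, Y) \<in> P"
          using cols[of "low + q"] inner q by auto
        from sqI[OF this] q show ?thesis by auto
      next
        case oy
        then obtain q where q: "y = 2 * q + 1" by (elim oddE)
        obtain X where "(X, low + q) \<in> P"
          using rows[of "low + q"] inner q by auto
        from sqI[OF this] q show ?thesis by auto
      next
        case even
        then obtain p q where pq: "x = 2 * p" "y = 2 * q" by (elim evenE)
        obtain X Y where XY: "(X, Y) \<in> P" "X - Y = (low + p - 1) - (low + q - 1) \<or> X + Y = (low + p - 1) + (low + q - 1) + 1"
          using diags[of "low + p - 1" "low + q - 1"] inner pq by auto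
        from XY(2) have "2 * (X - low) + 1 - (2 * (Y - low) + 1) = x - y \<or>
            2 * (X - low) + 1 + (2 * (Y - low) + 1) = x + y"
          using pq by auto
        with sqI[OF XY(1)] show ?thesis by blast
      qed
    qed
  qed
  also have "card ?Q \<le> card P + card border"
    using fin by (intro card_Un_le[THEN order_trans] add_mono card_image_le) (auto simp: border_def)
  also have "card border \<le> nat (4 * r)"
  proof -
    have "card border \<le> card {1..2 * r} + card {4 * W + 2 - 2 * r..4 * W + 1}"
      unfolding border_def by (rule card_Un_le)
    also have "\<dots> = nat (4 * r)" using r by simp
    finally show ?thesis .
  qed
  finally show ?thesis by simp
qed

section \<open>Enlarging an arrangement of blocks\<close>

lemma near_multiple:
  fixes z s w h :: int
  assumes "0 < s" "s - 1 \<le> w" "0 \<le> h" "- (h * s) \<le> z" "z \<le> h * s + w"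
  obtains i where "\<bar>i\<bar> \<le> h" "i * s \<le> z" "z \<le> i * s + w"
proof (cases "z \<le> h * s")
  case True
  have z: "z = (z div s) * s + z mod s" by simp
  have m: "0 \<le> z mod s" "z mod s < s" using assms(1) by auto
  have "z div s * s \<le> h * s" using z m True by linarith
  then have "z div s \<le> h" using assms(1) by simp
  moreover have "(- h - 1) * s = - (h * s) - s" by (simp add: algebra_simps)
  with z m assms(4) have "(- h - 1) * s < z div s * s" by linarith
  then have "- h - 1 < z div s" using assms(1) by (simp only: mult_less_cancel_right)
  ultimately have "\<bar>z div s\<bar> \<le> h" by linarith
  moreover have "z div s * s \<le> z" "z \<le> z div s * s + w" using z m assms(2) by linarith+
  ultimately show ?thesis by (rule that)
next
  case False
  then show ?thesis using assms by (intro that[of h]) auto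
qed

lemma double_mod:
  fixes m t :: int
  assumes "0 \<le> t"
  shows "t \<le> 3 * m + 3 \<Longrightarrow> (2 * t) mod (6 * m + 7) = 2 * t"
    and "3 * m + 4 \<le> t \<Longrightarrow> t \<le> 6 * m + 6 \<Longrightarrow> (2 * t) mod (6 * m + 7) = 2 * t - (6 * m + 7)"
proof -
  show "(2 * t) mod (6 * m + 7) = 2 * t" if "t \<le> 3 * m + 3"
    using assms that by (intro mod_pos_pos_trivial) auto
  show "(2 * t) mod (6 * m + 7) = 2 * t - (6 * m + 7)" if "3 * m + 4 \<le> t" "t \<le> 6 * m + 6"
  proof -
    have "(2 * t) mod (6 * m + 7) = (2 * t - (6 * m + 7)) mod (6 * m + 7)" by simp
    also have "\<dots> = 2 * t - (6 * m + 7)" using that by (intro mod_pos_pos_trivial) auto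
    finally show ?thesis .
  qed
qed

text \<open>
  A block \<open>(i, a, j, b)\<close> sits in cell \<open>(i, j)\<close> of a board of \<open>2 h + 1\<close> by \<open>2 h + 1\<close> cells with the
  origin in the middle. Its queens have \<open>X\<close> of the parity of \<open>a\<close> and \<open>Y\<close> of the parity of \<open>b\<close>, so a
  cell of the \<open>X\<close>-axis has to be hit by a block for either parity. The offset \<open>(- 1, 1)\<close> takes the
  place of \<open>(1, 1)\<close>: the residues of the sums modulo 3 have to agree along a chain of blocks, which
  requires that \<open>a + b\<close> depends only on its parity. The odd-numbered diagonals have to be occupied up
  to \<open>e\<close> cells from the centre and the even-numbered ones up to \<open>f\<close> cells.
\<close>

locale block_cover =
  fixes B :: "(int \<times> int \<times> int \<times> int) set" and h e f :: int
  assumes fin: "finite B"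
    and half_widths: "0 \<le> f" "0 \<le> e" "e < 2 * h" "f < 2 * h" "e + f = 2 * h"
    and shape: "\<And>i a j b. (i, a, j, b) \<in> B \<Longrightarrow>
          \<bar>i\<bar> \<le> h \<and> \<bar>j\<bar> \<le> h \<and> (a, b) \<in> {(0, 0), (1, 0), (0, 1), (-1, 1)}"
    and col_cells: "\<And>i. \<bar>i\<bar> \<le> h \<Longrightarrow> \<exists>a j b. (i, a, j, b) \<in> B \<and> even a"
          "\<And>i. \<bar>i\<bar> \<le> h \<Longrightarrow> \<exists>a j b. (i, a, j, b) \<in> B \<and> odd a"
    and row_cells: "\<And>j. \<bar>j\<bar> \<le> h \<Longrightarrow> \<exists>i a b. (i, a, j, b) \<in> B \<and> even b"
          "\<And>j. \<bar>j\<bar> \<le> h \<Longrightarrow> \<exists>i a b. (i, a, j, b) \<in> B \<and> odd b"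
    and diff_cells: "\<And>d. \<bar>d\<bar> \<le> f \<Longrightarrow> \<exists>i a j b. (i, a, j, b) \<in> B \<and> i - j = d \<and> a + b = 0"
          "\<And>d. \<bar>d\<bar> \<le> e \<Longrightarrow> \<exists>i a j b. (i, a, j, b) \<in> B \<and> i - j = d \<and> a + b = 1"
    and sum_cells: "\<And>s. \<bar>s\<bar> \<le> f \<Longrightarrow> \<exists>i a j b. (i, a, j, b) \<in> B \<and> i + j = s \<and> a + b = 0"
          "\<And>s. \<bar>s\<bar> \<le> e \<Longrightarrow> \<exists>i a j b. (i, a, j, b) \<in> B \<and> i + j = s \<and> a + b = 1"

locale block_blow_up = block_cover +
  fixes m :: int
  assumes m: "1 \<le> m"
begin

text \<open>
  Both numbers are 1 modulo 3, which makes the residues of the sums advance with the position of the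
  block, and the block size is odd, so that doubling permutes its residues. Blocks exceed the spacing
  of the cells by 3, so that neighbouring blocks overlap in spite of their offsets \<open>a\<close> and \<open>b\<close>.
\<close>

definition spacing :: int where "spacing = 6 * m + 4"

definition block_size :: int where "block_size = 6 * m + 7"

definition block :: "int \<times> int \<times> int \<times> int \<Rightarrow> (int \<times> int) set" where
  "block = (\<lambda>(i, a, j, b).
     (\<lambda>t. (2 * (i * spacing + t) + a, 2 * (j * spacing + (2 * t) mod block_size) + b)) ` {0..<block_size})"

text \<open>
  In the range that has to be occupied, these include all sums that a chain of blocks with sum
  positions \<open>- g, \<dots>, g\<close> misses: at its two ends there is no neighbour to contribute the third residue
  modulo 3. The sum \<open>2 v + c\<close> is occupied by a queen at \<open>(v, v + c)\<close>.
\<close>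

definition end_patch :: "int \<Rightarrow> int \<Rightarrow> (int \<times> int) set" where
  "end_patch g c =
     (\<lambda>v. (v, v + c)) ` ((\<lambda>s. - (g * spacing) + 3 * s + 1) ` {m..2 * m + 1}
                        \<union> (\<lambda>s. (g + 1) * spacing + 3 * s) ` {0..m + 1})"

definition half_board_queens :: "(int \<times> int) set" where
  "half_board_queens = (\<Union>x\<in>B. block x) \<union> end_patch f 0 \<union> end_patch e 1"

lemma block_queenI:
  assumes "(i, a, j, b) \<in> B" "0 \<le> t" "t < block_size"
  shows "(2 * (i * spacing + t) + a, 2 * (j * spacing + (2 * t) mod block_size) + b)
           \<in> half_board_queens"
  using assms unfolding half_board_queens_def block_def by fastforce

lemma column_occupied:
  assumes "- (2 * h * spacing) + 1 \<le> X" "X \<le> 2 * h * spacing + 2 * block_size - 3"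
  shows "\<exists>Y. (X, Y) \<in> half_board_queens"
proof -
  obtain i where i: "\<bar>i\<bar> \<le> h" "i * (2 * spacing) \<le> X - 1" "X - 1 \<le> i * (2 * spacing) + (2 * block_size - 4)"
  proof (rule near_multiple[of "2 * spacing" "2 * block_size - 4" h "X - 1"])
  qed (use m half_widths assms in \<open>auto simp: spacing_def block_size_def algebra_simps\<close>)
  obtain a j b where blk: "(i, a, j, b) \<in> B" "even (X - a)"
    using col_cells[OF i(1)] by (cases "even X") auto
  have a: "-1 \<le> a" "a \<le> 1" using shape[OF blk(1)] by auto
  define t where "t = (X - a) div 2 - i * spacing"
  have X: "X = 2 * (i * spacing + t) + a" using blk(2) by (auto simp: t_def elim!: evenE)
  have "0 \<le> t" "t < block_size" using i(2,3) a X by (auto simp: algebra_simps)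
  from block_queenI[OF blk(1) this] X show ?thesis by auto
qed

text \<open>Doubling permutes the residues modulo the block size: an even \<open>u\<close> is twice \<open>u / 2\<close>, an odd one is
  congruent to twice \<open>(u + K) / 2\<close>.\<close>

lemma row_occupied:
  assumes "- (2 * h * spacing) + 1 \<le> Y" "Y \<le> 2 * h * spacing + 2 * block_size - 3"
  shows "\<exists>X. (X, Y) \<in> half_board_queens"
proof -
  obtain j where j: "\<bar>j\<bar> \<le> h" "j * (2 * spacing) \<le> Y - 1" "Y - 1 \<le> j * (2 * spacing) + (2 * block_size - 4)"
  proof (rule near_multiple[of "2 * spacing" "2 * block_size - 4" h "Y - 1"])
  qed (use m half_widths assms in \<open>auto simp: spacing_def block_size_def algebra_simps\<close>)
  obtain i a b where blk: "(i, a, j, b) \<in> B" "even (Y - b)"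
    using row_cells[OF j(1)] by (cases "even Y") auto
  have b: "0 \<le> b" "b \<le> 1" using shape[OF blk(1)] by auto
  define u where "u = (Y - b) div 2 - j * spacing"
  have Y: "Y = 2 * (j * spacing + u) + b" using blk(2) by (auto simp: u_def elim!: evenE)
  have u: "0 \<le> u" "u < block_size" using j(2,3) b Y by (auto simp: algebra_simps)
  obtain t where t: "0 \<le> t" "t < block_size" "(2 * t) mod block_size = u"
  proof (cases "even u")
    case True
    then obtain q where "u = 2 * q" by (elim evenE)
    with u show ?thesis using double_mod(1)[of q m] by (intro that[of q]) (auto simp: block_size_def)
  next
    case False
    then obtain q where "u = 2 * q + 1" by (elim oddE)
    with u show ?thesis using double_mod(2)[of "q + 3 * m + 4" m]
      by (intro that[of "q + 3 * m + 4"]) (auto simp: block_size_def)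
  qed
  from block_queenI[OF blk(1) t(1,2)] t(3) Y show ?thesis by auto
qed

text \<open>
  In a block of size \<open>K\<close> the difference \<open>t - (2 t mod K)\<close> is \<open>- t\<close> for the first half of the values \<open>t\<close>
  and \<open>K - t\<close> for the second half. It thus runs through an interval centred at 0.
\<close>

lemma difference_occupied:
  assumes "\<bar>D\<bar> \<le> 2 * (if even D then f else e) * spacing + block_size - 3"
  shows "\<exists>X Y. (X, Y) \<in> half_board_queens \<and> X - Y = D"
proof -
  define g where "g = (if even D then f else e)"
  have g: "0 \<le> g" using half_widths by (simp add: g_def)
  obtain d where d: "\<bar>d\<bar> \<le> g" "d * (2 * spacing) \<le> D + (block_size - 3)"
      "D + (block_size - 3) \<le> d * (2 * spacing) + (2 * block_size - 6)"
  proof (rule near_multiple[of "2 * spacing" "2 * block_size - 6" g "D + (block_size - 3)"])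
  qed (use m g assms in \<open>auto simp: spacing_def block_size_def algebra_simps g_def[symmetric]\<close>)
  obtain i a j b where blk: "(i, a, j, b) \<in> B" "i - j = d" "even (D - (a - b))"
    using diff_cells(1)[of d] diff_cells(2)[of d] d(1)
    by (cases "even D") (auto simp: g_def, (metis even_add even_diff odd_one even_zero)+)
  have ab: "-2 \<le> a - b" "a - b \<le> 1" using shape[OF blk(1)] by auto
  define w where "w = (D - (a - b)) div 2 - d * spacing"
  have D: "D = 2 * (d * spacing + w) + (a - b)" using blk(3) by (auto simp: w_def elim!: evenE)
  have w: "- (3 * m + 3) \<le> w" "w \<le> 3 * m + 3"
    using d(2,3) ab D by (auto simp: algebra_simps block_size_def)
  obtain t where t: "0 \<le> t" "t < block_size" "t - (2 * t) mod block_size = w"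
  proof (cases "w \<le> 0")
    case True
    with w show ?thesis using double_mod(1)[of "- w" m]
      by (intro that[of "- w"]) (auto simp: block_size_def)
  next
    case False
    with w show ?thesis using double_mod(2)[of "block_size - w" m]
      by (intro that[of "block_size - w"]) (auto simp: block_size_def)
  qed
  have "2 * (i * spacing + t) + a - (2 * (j * spacing + (2 * t) mod block_size) + b) = D"
    using D t(3) blk(2) by (auto simp: algebra_simps)
  with block_queenI[OF blk(1) t(1,2)] show ?thesis by blast
qed

text \<open>
  The sum \<open>t + (2 t mod K)\<close> is \<open>3 t\<close> for the first half of the values \<open>t\<close> and \<open>3 t - K\<close>, which is 2
  modulo 3, for the second half.
\<close>

lemma sum_in_block:
  assumes blk: "(i, a, j, b) \<in> B"
    and z: "(\<exists>q. z = 3 * q \<and> 0 \<le> q \<and> q \<le> 3 * m + 3) \<or> (\<exists>q. z = 3 * q + 2 \<and> m + 1 \<le> q \<and> q \<le> 4 * m + 3)"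
  shows "\<exists>X Y. (X, Y) \<in> half_board_queens \<and> X + Y = 2 * ((i + j) * spacing + z) + (a + b)"
proof -
  obtain t where t: "0 \<le> t" "t < block_size" "t + (2 * t) mod block_size = z"
    using z
  proof (elim disjE exE conjE)
    fix q assume "z = 3 * q" "0 \<le> q" "q \<le> 3 * m + 3"
    then show thesis using m double_mod(1)[of q m]
      by (intro that[of q]) (auto simp: block_size_def)
  next
    fix q assume "z = 3 * q + 2" "m + 1 \<le> q" "q \<le> 4 * m + 3"
    then show thesis using m double_mod(2)[of "q + 2 * m + 3" m]
      by (intro that[of "q + 2 * m + 3"]) (auto simp: block_size_def)
  qed
  have "2 * (i * spacing + t) + a + (2 * (j * spacing + (2 * t) mod block_size) + b)
          = 2 * ((i + j) * spacing + z) + (a + b)"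
    using t(3) by (auto simp: algebra_simps)
  with block_queenI[OF blk t(1,2)] show ?thesis by blast
qed

text \<open>
  Write the sum as \<open>2 v + c\<close> and \<open>v = s * spacing + z\<close> with \<open>0 \<le> z < spacing\<close>. A block at sum position
  \<open>s\<close> supplies \<open>z \<equiv> 0\<close>, and \<open>z \<equiv> 2\<close> in the upper half. A block at position \<open>s - 1\<close> sees \<open>v\<close> at
  \<open>z + spacing \<equiv> z + 1\<close>, so that it supplies \<open>z \<equiv> 1\<close>, and \<open>z \<equiv> 2\<close> in the lower half (all modulo 3).
  Hence a sum is occupied if both positions carry blocks of the class \<open>c\<close>. At the ends of the chain
  one of the two is missing, and the required range extends only over half a cell; there the
  residue 1, respectively 0, is left to the single queens of the patch.
\<close>

lemma sum_occupied:
  assumes "\<bar>S - (2 * block_size - 2)\<bar> \<le> 2 * (if even S then f else e) * spacing + block_size - 6"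
  shows "\<exists>X Y. (X, Y) \<in> half_board_queens \<and> X + Y = S"
proof -
  define g c :: int where "g = (if even S then f else e)" and "c = (if even S then 0 else 1)"
  have g: "0 \<le> g" using half_widths by (simp add: g_def)
  define v where "v = S div 2"
  have S: "S = 2 * v + c" by (auto simp: v_def c_def elim!: oddE)
  have sizes: "spacing = 6 * m + 4" "block_size = 6 * m + 7" "(g + 1) * spacing = g * spacing + spacing"
    by (simp_all add: spacing_def block_size_def algebra_simps)
  have c: "c \<in> {0, 1}" by (simp add: c_def)
  have "\<bar>2 * v + c - (2 * block_size - 2)\<bar> \<le> 2 * (g * spacing) + block_size - 6"
    using assms unfolding g_def S[symmetric] by (simp add: mult.assoc)
  with c sizes have v: "- (g * spacing) + 3 * m + 5 \<le> v" "v \<le> (g + 1) * spacing + 3 * m + 4"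
    by auto
  have cell: "\<exists>i a j b. (i, a, j, b) \<in> B \<and> i + j = s \<and> a + b = c" if "\<bar>s\<bar> \<le> g" for s
    using sum_cells[of s] that by (auto simp: g_def c_def split: if_splits)
  \<comment> \<open>The two progressions of a block at sum position \<open>s\<close>.\<close>
  have A: "\<exists>X Y. (X, Y) \<in> half_board_queens \<and> X + Y = S"
    if "\<bar>s\<bar> \<le> g" "v = s * spacing + 3 * q" "0 \<le> q" "q \<le> 3 * m + 3" for s q
  proof -
    from cell[OF that(1)] obtain i a j b where "(i, a, j, b) \<in> B" "i + j = s" "a + b = c" by blast
    with sum_in_block[of i a j b "3 * q"] that S show ?thesis by auto
  qed
  have Bb: "\<exists>X Y. (X, Y) \<in> half_board_queens \<and> X + Y = S"
    if "\<bar>s\<bar> \<le> g" "v = s * spacing + 3 * q + 2" "m + 1 \<le> q" "q \<le> 4 * m + 3" for s q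
  proof -
    from cell[OF that(1)] obtain i a j b where "(i, a, j, b) \<in> B" "i + j = s" "a + b = c" by blast
    with sum_in_block[of i a j b "3 * q + 2"] that S show ?thesis by (auto simp: add.assoc)
  qed
  have patch: "\<exists>X Y. (X, Y) \<in> half_board_queens \<and> X + Y = S"
    if "v \<in> (\<lambda>s. - (g * spacing) + 3 * s + 1) ` {m..2 * m + 1} \<union> (\<lambda>s. (g + 1) * spacing + 3 * s) ` {0..m + 1}"
  proof -
    have "(v, v + c) \<in> end_patch g c" unfolding end_patch_def using that by blast
    then have "(v, v + c) \<in> half_board_queens"
      by (auto simp: half_board_queens_def g_def c_def split: if_splits)
    with S show ?thesis by (intro exI[of _ v] exI[of _ "v + c"]) auto
  qed
  define s z where "s = v div spacing" and "z = v mod spacing"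
  have sp: "0 < spacing" using m by (simp add: spacing_def)
  have vz: "v = s * spacing + z" "0 \<le> z" "z < spacing" using sp by (auto simp: s_def z_def)
  have vz': "v = (s - 1) * spacing + (z + spacing)" using vz(1) by (simp add: algebra_simps)
  have lo: "- g \<le> s"
  proof (rule ccontr)
    assume "\<not> ?thesis"
    then have "s * spacing \<le> (- g - 1) * spacing" using sp by (intro mult_right_mono) auto
    with vz v m show False by (simp add: algebra_simps)
  qed
  have hi: "s \<le> g + 1"
  proof (rule ccontr)
    assume "\<not> ?thesis"
    then have "(g + 2) * spacing \<le> s * spacing" using sp by (intro mult_right_mono) auto
    with vz v m show False by (simp add: algebra_simps spacing_def)
  qed
  obtain q where q: "z = 3 * q \<or> z = 3 * q + 1 \<or> z = 3 * q + 2"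
  proof (rule that)
    show "z = 3 * (z div 3) \<or> z = 3 * (z div 3) + 1 \<or> z = 3 * (z div 3) + 2" by presburger
  qed
  consider "s = - g" | "- g < s" "s \<le> g" | "s = g + 1" using lo hi by linarith
  then show ?thesis
  proof cases
    case 1
    then have s: "\<bar>s\<bar> \<le> g" and vg: "v = - (g * spacing) + z" using g vz(1) by auto
    from q show ?thesis
    proof (elim disjE)
      assume "z = 3 * q"
      with vz m sizes show ?thesis by (intro A[OF s, of q]) simp_all
    next
      assume z: "z = 3 * q + 1"
      with vg v(1) vz(3) sizes have "q \<in> {m..2 * m + 1}" by auto
      moreover from vg z have "v = - (g * spacing) + 3 * q + 1" by simp
      ultimately show ?thesis by (intro patch) blast
    next
      assume "z = 3 * q + 2"
      with vg v(1) vz m sizes show ?thesis by (intro Bb[OF s, of q]) simp_all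
    qed
  next
    case 2
    then have s: "\<bar>s\<bar> \<le> g" "\<bar>s - 1\<bar> \<le> g" by auto
    from q show ?thesis
    proof (elim disjE)
      assume "z = 3 * q"
      with vz m sizes show ?thesis by (intro A[OF s(1), of q]) simp_all
    next
      assume "z = 3 * q + 1"
      with vz(2,3) vz' m sizes(1) show ?thesis by (intro Bb[OF s(2), of "q + 2 * m + 1"]) simp_all
    next
      assume z: "z = 3 * q + 2"
      show ?thesis
      proof (cases "m + 1 \<le> q")
        case True
        with z vz m sizes show ?thesis by (intro Bb[OF s(1), of q]) simp_all
      next
        case False
        with z vz(2,3) vz' m sizes(1) show ?thesis by (intro A[OF s(2), of "q + 2 * m + 2"]) simp_all
      qed
    qed
  next
    case 3
    then have s: "\<bar>s - 1\<bar> \<le> g" and vg: "v = (g + 1) * spacing + z" using g vz(1) by auto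
    from q show ?thesis
    proof (elim disjE)
      assume z: "z = 3 * q"
      with vg v(2) vz(2) have "q \<in> {0..m + 1}" by auto
      moreover from vg z have "v = (g + 1) * spacing + 3 * q" by simp
      ultimately show ?thesis by (intro patch) blast
    next
      assume "z = 3 * q + 1"
      with vz(2,3) vz' m sizes(1) show ?thesis by (intro Bb[OF s, of "q + 2 * m + 1"]) simp_all
    next
      assume "z = 3 * q + 2"
      with vg v(2) vz(2,3) vz' m sizes show ?thesis by (intro A[OF s, of "q + 2 * m + 2"]) simp_all
    qed
  qed
qed

lemma card_half_board_queens:
  "card half_board_queens \<le> card B * nat block_size + nat (4 * m + 8)"
proof -
  have "card (\<Union>x\<in>B. block x) \<le> (\<Sum>x\<in>B. card (block x))"
    by (rule card_UN_le[OF fin])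
  also have "\<dots> \<le> (\<Sum>x\<in>B. nat block_size)"
  proof (rule sum_mono)
    fix x assume "x \<in> B"
    have "card (block x) \<le> card {0..<block_size}"
      unfolding block_def case_prod_beta by (rule card_image_le) simp
    then show "card (block x) \<le> nat block_size" by simp
  qed
  finally have 1: "card (\<Union>x\<in>B. block x) \<le> card B * nat block_size" by simp
  have 2: "card (end_patch g c) \<le> nat (2 * m + 4)" for g c
  proof -
    have "card (end_patch g c) \<le> card {m..2 * m + 1} + card {0..m + 1}"
      unfolding end_patch_def
      by (intro card_image_le[THEN order_trans] card_Un_le[THEN order_trans] add_mono card_image_le) auto
    then show ?thesis using m by (simp add: nat_add_distrib[symmetric])
  qed
  have "card half_board_queens \<le> card (\<Union>x\<in>B. block x) + card (end_patch f 0) + card (end_patch e 1)"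
    unfolding half_board_queens_def by (intro card_Un_le[THEN order_trans] add_mono card_Un_le order_refl)
  with 1 2[of f 0] 2[of e 1] m show ?thesis by linarith
qed

definition reach :: int where "reach = 2 * h * spacing + block_size"

definition half_board :: "int set" where
  "half_board = {- (2 * h * spacing) - 1..- (2 * h * spacing) - 1 + 2 * reach}"

lemma half_board_queens_subset:
  "half_board_queens \<subseteq> half_board \<times> half_board"
proof -
  have cellrange: "- (h * spacing) \<le> i * spacing \<and> i * spacing \<le> h * spacing" if "\<bar>i\<bar> \<le> h" for i
  proof -
    have "i * spacing \<le> h * spacing" "(- h) * spacing \<le> i * spacing"
      using that m by (intro mult_right_mono; simp add: spacing_def)+
    then show ?thesis by simp
  qed
  have blocks: "block (i, a, j, b) \<subseteq> half_board \<times> half_board" if "(i, a, j, b) \<in> B" for i a j b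
  proof -
    have bs: "0 < block_size" using m by (simp add: block_size_def)
    have md: "0 \<le> (2 * t) mod block_size" "(2 * t) mod block_size < block_size" for t using bs by auto
    from shape[OF that] have sh: "\<bar>i\<bar> \<le> h" "\<bar>j\<bar> \<le> h" "-1 \<le> a" "a \<le> 1" "0 \<le> b" "b \<le> 1" by auto
    show ?thesis
    proof (clarsimp simp: block_def half_board_def reach_def, goal_cases)
      case (1 t)
      with cellrange[OF sh(1)] cellrange[OF sh(2)] sh(3-) md[of t] show ?case by linarith
    qed
  qed
  have patches: "end_patch g c \<subseteq> half_board \<times> half_board"
    if "0 \<le> g" "g < 2 * h" "c \<in> {0, 1}" for g c
  proof -
    have "(g + 1) * spacing \<le> (2 * h) * spacing"
      using that m by (intro mult_right_mono) (auto simp: spacing_def)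
    moreover have "0 \<le> g * spacing" using that m by (simp add: spacing_def)
    moreover have "(g + 1) * spacing = g * spacing + spacing" by (simp add: algebra_simps)
    ultimately have gs: "0 \<le> g * spacing" "g * spacing + spacing \<le> 2 * h * spacing"
      and c: "0 \<le> c" "c \<le> 1" and sizes: "spacing = 6 * m + 4" "block_size = 6 * m + 7"
      using that by (auto simp: spacing_def block_size_def)
    have *: "(v, v + c) \<in> half_board \<times> half_board"
      if "- (g * spacing) \<le> v" "v \<le> g * spacing + spacing + 3 * m + 3" for v
      using that gs c sizes m unfolding half_board_def reach_def by auto
    show ?thesis
      unfolding end_patch_def
    proof (intro image_subsetI, elim UnE imageE)
      fix v s assume "v = - (g * spacing) + 3 * s + 1" "s \<in> {m..2 * m + 1}"
      then show "(v, v + c) \<in> half_board \<times> half_board"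
        using gs sizes m by (intro *) auto
    next
      fix v s assume "v = (g + 1) * spacing + 3 * s" "s \<in> {0..m + 1}"
      then show "(v, v + c) \<in> half_board \<times> half_board"
        using gs sizes m by (intro *) (auto simp: ring_distribs)
    qed
  qed
  from blocks have "(\<Union>x\<in>B. block x) \<subseteq> half_board \<times> half_board"
    by (intro UN_least) (auto simp only: split_paired_all)
  with patches[of f 0] patches[of e 1] half_widths show ?thesis
    unfolding half_board_queens_def by simp
qed

text \<open>
  The numbers \<open>\<xi> - \<eta>\<close> and \<open>\<xi> + \<eta> + 1\<close> have opposite parity. If neither were occupied, their distances
  from the centre would exceed \<open>e\<close> and \<open>f\<close> cells (in one order or the other), and by
  \<open>e + f = 2 h\<close> one of \<open>\<xi>\<close> and \<open>\<eta>\<close> would violate its bounds.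
\<close>

lemma diagonal_occupied:
  assumes "\<xi> \<in> {- (2 * h * spacing) + 4..2 * h * spacing + 2 * block_size - 6}"
    and "\<eta> \<in> {- (2 * h * spacing) + 4..2 * h * spacing + 2 * block_size - 6}"
  shows "\<exists>X Y. (X, Y) \<in> half_board_queens \<and> (X - Y = \<xi> - \<eta> \<or> X + Y = \<xi> + \<eta> + 1)"
proof (rule ccontr)
  assume no: "\<not> ?thesis"
  define g where "g = (if even (\<xi> - \<eta>) then f else e)"
  have g': "(if even (\<xi> + \<eta> + 1) then f else e) = 2 * h - g"
    using half_widths by (auto simp: g_def)
  have "\<bar>\<xi> - \<eta>\<bar> > 2 * g * spacing + block_size - 3"
    using difference_occupied[of "\<xi> - \<eta>"] no unfolding g_def by fastforce
  moreover have "\<bar>\<xi> + \<eta> + 1 - (2 * block_size - 2)\<bar> > 2 * (2 * h - g) * spacing + block_size - 6"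
    using sum_occupied[of "\<xi> + \<eta> + 1"] no unfolding g' by fastforce
  ultimately show False using assms by (simp add: algebra_simps abs_if split: if_splits)
qed

theorem queen_domination_blow_up:
  "queen_domination (nat (4 * reach + 1)) \<le> card B * nat (6 * m + 7) + nat (4 * m + 28)"
proof -
  have "queen_domination (nat (4 * reach + 1)) \<le> card half_board_queens + nat (4 * 5)"
  proof (rule queen_domination_half_board[where low = "- (2 * h * spacing) - 1"])
    show "finite half_board_queens"
      using half_board_queens_subset by (rule finite_subset) (simp add: half_board_def)
    have "0 \<le> 2 * h * spacing" using half_widths m by (simp add: spacing_def)
    then show "5 \<le> reach" using m by (simp add: reach_def block_size_def)
  qed (use half_board_queens_subset[unfolded half_board_def] column_occupied row_occupied diagonal_occupied
       in \<open>auto simp: reach_def algebra_simps\<close>)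
  with card_half_board_queens show ?thesis using m by (simp add: block_size_def nat_add_distrib)
qed

end

section \<open>Arrangements with quarter-turn symmetry\<close>

text \<open>
  In this section \<open>(i, p, j, q)\<close> with bits \<open>p\<close> and \<open>q\<close> denotes the block in cell \<open>(i, j)\<close> whose queens have
  \<open>X\<close> of parity \<open>p\<close> and \<open>Y\<close> of parity \<open>q\<close>; this form is preserved by quarter turns.
\<close>

definition place :: "int \<times> int \<times> int \<times> int \<Rightarrow> int \<times> int \<times> int \<times> int" where
  "place = (\<lambda>(i, p, j, q). (i, if p = 1 \<and> q = 1 then - 1 else p, j, q))"

definition quarter_turns :: "int \<times> int \<times> int \<times> int \<Rightarrow> (int \<times> int \<times> int \<times> int) list" where
  "quarter_turns = (\<lambda>(i, p, j, q).
     map place [(i, p, j, q), (- j, q, i, p), (- i, p, - j, q), (j, q, - i, p)])"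

text \<open>
  A full orbit of blocks would hit the lines through the central cell twice, so they are served by
  single blocks in this cell. The first two take the rows and columns of both parities and the
  even-numbered diagonals, the third one takes the odd-numbered diagonals.
\<close>

definition central_blocks :: "(int \<times> int \<times> int \<times> int) list" where
  "central_blocks = map place [(0, 0, 0, 0), (0, 1, 0, 1), (0, 1, 0, 0)]"

definition symmetric_blocks ::
  "(int \<times> int \<times> int \<times> int) list \<Rightarrow> (int \<times> int \<times> int \<times> int) list" where
  "symmetric_blocks seeds = central_blocks @ concat (map quarter_turns seeds)"

text \<open>
  The four turns of a block \<open>(x, p, y, q)\<close> have rows and columns \<open>\<plusminus>x\<close> with parity \<open>p\<close> and \<open>\<plusminus>y\<close> with parity
  \<open>q\<close>, and their differences as well as their sums are \<open>\<plusminus>(x - y)\<close> and \<open>\<plusminus>(x + y)\<close>. So one only has to pair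
  up the numbers from 1 to \<open>h\<close>, taken once with each parity, such that the differences and sums of the pairs
  cover two initial segments.
\<close>

lemma block_cover_symmetric_blocks:
  assumes widths: "0 \<le> f" "0 \<le> e" "e < 2 * h" "f < 2 * h" "e + f = 2 * h"
    and seeds: "\<And>x p y q. (x, p, y, q) \<in> set seeds \<Longrightarrow>
          0 \<le> x \<and> x \<le> h \<and> 0 \<le> y \<and> y \<le> h \<and> p \<in> {0, 1} \<and> q \<in> {0, 1}"
    and lines: "\<And>x p. 1 \<le> x \<Longrightarrow> x \<le> h \<Longrightarrow> p \<in> {0, 1} \<Longrightarrow>
          \<exists>y q. (x, p, y, q) \<in> set seeds \<or> (y, q, x, p) \<in> set seeds"
    and diagonals: "\<And>v. 1 \<le> v \<Longrightarrow> v \<le> f \<Longrightarrow>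
          \<exists>x p y q. (x, p, y, q) \<in> set seeds \<and> p = q \<and> (v = \<bar>x - y\<bar> \<or> v = x + y)"
          "\<And>v. 1 \<le> v \<Longrightarrow> v \<le> e \<Longrightarrow>
          \<exists>x p y q. (x, p, y, q) \<in> set seeds \<and> p \<noteq> q \<and> (v = \<bar>x - y\<bar> \<or> v = x + y)"
  shows "block_cover (set (symmetric_blocks seeds)) h e f"
proof -
  let ?B = "set (symmetric_blocks seeds)"
  have turns: "place (x, p, y, q) \<in> ?B" "place (- y, q, x, p) \<in> ?B"
      "place (- x, p, - y, q) \<in> ?B" "place (y, q, - x, p) \<in> ?B" if "(x, p, y, q) \<in> set seeds" for x p y q
    using that by (auto simp: symmetric_blocks_def quarter_turns_def intro!: bexI[of _ "(x, p, y, q)"])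
  have center: "(0, 0, 0, 0) \<in> ?B" "(0, - 1, 0, 1) \<in> ?B" "(0, 1, 0, 0) \<in> ?B"
    by (simp_all add: symmetric_blocks_def central_blocks_def place_def)
  have placed: "\<exists>a b. (i, a, j, b) \<in> ?B \<and> (even a \<longleftrightarrow> p = 0) \<and> (even b \<longleftrightarrow> q = 0) \<and> a + b = (if p = q then 0 else 1)"
    if "place (i, p, j, q) \<in> ?B" "p \<in> {0, 1}" "q \<in> {0, 1}" for i p j q
    using that
    by (intro exI[of _ "if p = 1 \<and> q = 1 then - 1 else p"] exI[of _ q]) (auto simp: place_def)
  have col: "\<exists>a j b. (i, a, j, b) \<in> ?B \<and> (even a \<longleftrightarrow> p = 0)" if "\<bar>i\<bar> \<le> h" "p \<in> {0, 1}" for i p :: int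
  proof (cases "i = 0")
    case True
    with center that(2) show ?thesis by (cases "p = 0") force+
  next
    case False
    then have "1 \<le> \<bar>i\<bar>" by linarith
    with lines[of "\<bar>i\<bar>" p] that obtain y q
      where yq: "(\<bar>i\<bar>, p, y, q) \<in> set seeds \<or> (y, q, \<bar>i\<bar>, p) \<in> set seeds" by auto
    with seeds have q: "q \<in> {0, 1}" by blast
    from yq have "\<exists>j. place (i, p, j, q) \<in> ?B"
      using turns[of "\<bar>i\<bar>" p y q] turns[of y q "\<bar>i\<bar>" p] by (cases "0 \<le> i") auto
    with placed q that(2) show ?thesis by blast
  qed
  have row: "\<exists>i a b. (i, a, j, b) \<in> ?B \<and> (even b \<longleftrightarrow> q = 0)" if "\<bar>j\<bar> \<le> h" "q \<in> {0, 1}" for j q :: int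
  proof (cases "j = 0")
    case True
    with center that(2) show ?thesis by (cases "q = 0") force+
  next
    case False
    then have "1 \<le> \<bar>j\<bar>" by linarith
    with lines[of "\<bar>j\<bar>" q] that obtain x p
      where xp: "(\<bar>j\<bar>, q, x, p) \<in> set seeds \<or> (x, p, \<bar>j\<bar>, q) \<in> set seeds" by auto
    with seeds have p: "p \<in> {0, 1}" by blast
    from xp have "\<exists>i. place (i, p, j, q) \<in> ?B"
      using turns[of "\<bar>j\<bar>" q x p] turns[of x p "\<bar>j\<bar>" q] by (cases "0 \<le> j") auto
    with placed p that(2) show ?thesis by blast
  qed
  have diag: "(\<exists>i a j b. (i, a, j, b) \<in> ?B \<and> i - j = d \<and> a + b = c) \<and>
      (\<exists>i a j b. (i, a, j, b) \<in> ?B \<and> i + j = d \<and> a + b = c)"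
    if "\<bar>d\<bar> \<le> (if c = 0 then f else e)" "c \<in> {0, 1}" for c d :: int
  proof (cases "d = 0")
    case True
    with center that(2) show ?thesis by (cases "c = 0") force+
  next
    case False
    then have d1: "1 \<le> \<bar>d\<bar>" by linarith
    have "\<exists>x p y q. (x, p, y, q) \<in> set seeds \<and> c = (if p = q then 0 else 1) \<and>
        (\<bar>d\<bar> = \<bar>x - y\<bar> \<or> \<bar>d\<bar> = x + y)"
    proof (cases "c = 0")
      case True
      with that(1) diagonals(1)[OF d1] show ?thesis by force
    next
      case c: False
      with that diagonals(2)[OF d1] show ?thesis by force
    qed
    then obtain x p y q where xy: "(x, p, y, q) \<in> set seeds" "c = (if p = q then 0 else 1)"
        "\<bar>d\<bar> = \<bar>x - y\<bar> \<or> \<bar>d\<bar> = x + y" by blast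
    note pq = seeds[OF xy(1)]
    have diff: "\<exists>i a j b. (i, a, j, b) \<in> ?B \<and> i - j = d \<and> a + b = c"
      if "place (i, p', j, q') \<in> ?B" "p' \<in> {0, 1}" "q' \<in> {0, 1}" "c = (if p' = q' then 0 else 1)"
        "i - j = d" for i j p' q'
      using placed[OF that(1-3)] that(4,5) by blast
    have sum: "\<exists>i a j b. (i, a, j, b) \<in> ?B \<and> i + j = d \<and> a + b = c"
      if "place (i, p', j, q') \<in> ?B" "p' \<in> {0, 1}" "q' \<in> {0, 1}" "c = (if p' = q' then 0 else 1)"
        "i + j = d" for i j p' q'
      using placed[OF that(1-3)] that(4,5) by blast
    have p: "p \<in> {0, 1}" and q: "q \<in> {0, 1}" and c: "c = (if q = p then 0 else 1)"
      using pq xy(2) by auto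
    note turn = turns[OF xy(1)]
    consider "d = x - y" | "d = y - x" | "d = x + y" | "d = - x - y"
      using xy(3) by linarith
    then show ?thesis
    proof cases
      case 1
      then show ?thesis using diff[OF turn(1) p q xy(2)] sum[OF turn(2) q p c] by simp
    next
      case 2
      then show ?thesis using diff[OF turn(3) p q xy(2)] sum[OF turn(4) q p c] by simp
    next
      case 3
      then show ?thesis using diff[OF turn(4) q p c] sum[OF turn(1) p q xy(2)] by simp
    next
      case 4
      then show ?thesis using diff[OF turn(2) q p c] sum[OF turn(3) p q xy(2)] by simp
    qed
  qed
  have shape: "\<bar>i\<bar> \<le> h \<and> \<bar>j\<bar> \<le> h \<and> (a, b) \<in> {(0, 0), (1, 0), (0, 1), (- 1, 1)}"
    if "(i, a, j, b) \<in> ?B" for i a j b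
  proof -
    from that consider "(i, a, j, b) \<in> set central_blocks"
      | x p y q where "(x, p, y, q) \<in> set seeds" "(i, a, j, b) \<in> set (quarter_turns (x, p, y, q))"
      by (auto simp: symmetric_blocks_def)
    then show ?thesis
    proof cases
      case 1
      with widths show ?thesis by (auto simp: central_blocks_def place_def)
    next
      case 2
      with seeds[OF 2(1)] show ?thesis by (auto simp: quarter_turns_def place_def)
    qed
  qed
  show ?thesis
    using widths shape col[of _ 0] col[of _ 1] row[of _ 0] row[of _ 1] diag[of _ 0] diag[of _ 1]
    by unfold_locales auto
qed

section \<open>An arrangement of 199 blocks\<close>

text \<open>
  The table solves a covering problem for \<open>h = 48\<close>, \<open>e = 75\<close> and \<open>f = 21\<close>. If 48 pairs used every number
  and every required difference or sum exactly once, the parallelogram law, summed over the pairs,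
  would force \<open>(e - h)\<^sup>2 = h (h + 1) / 3\<close>, hence \<open>e = 76\<close> and \<open>f = 20\<close>. A 49th pair, with two entries and
  two diagonals beyond the necessary ones, relaxes this rigid condition at the price of 4 blocks.
\<close>

definition seeds :: "(int \<times> int \<times> int \<times> int) list" where
  "seeds = [
     (1,0,5,0), (2,0,7,0), (2,1,43,0), (3,0,11,0), (3,1,13,1), (4,0,16,0), (4,1,15,1),
     (8,0,46,1), (8,1,10,1), (10,0,11,0), (12,1,5,1), (13,0,29,1), (14,1,1,1), (17,0,39,1),
     (18,0,42,1), (18,1,48,0), (19,0,48,1), (19,1,28,0), (20,0,16,1), (21,0,27,1),
     (21,1,47,0), (22,0,47,1), (22,1,40,0), (24,0,37,1), (25,1,15,0), (26,0,23,1),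
     (28,1,36,0), (29,0,24,1), (30,0,7,1), (30,1,44,0), (31,0,32,1), (32,0,11,1),
     (33,0,17,1), (33,1,2,0), (34,0,36,1), (34,1,41,0), (35,0,38,0), (35,1,23,0), (37,0,9,1),
     (38,1,6,0), (39,0,20,1), (40,1,25,0), (41,1,14,0), (42,0,31,1), (43,1,9,0), (44,1,27,0),
     (45,0,6,1), (45,1,12,0), (46,0,26,1)]"

lemma seeds_in_range:
  "list_all (\<lambda>(x, p, y, q). 0 \<le> x \<and> x \<le> 48 \<and> 0 \<le> y \<and> y \<le> 48 \<and> (p = 0 \<or> p = 1) \<and> (q = 0 \<or> q = 1)) seeds"
  by code_simp

text \<open>The number \<open>2 x + p\<close> encodes \<open>x\<close> together with its parity \<open>p\<close>.\<close>

lemma seeds_lines: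
  "remdups_adj (sort (concat (map (\<lambda>(x, p, y, q). [2 * x + p, 2 * y + q]) seeds))) = [2..97]"
  by code_simp

lemma seeds_diagonals_even:
  "remdups_adj (sort (filter (\<lambda>v. 1 \<le> v \<and> v \<le> 21)
     (concat (map (\<lambda>(x, p, y, q). if p = q then [\<bar>x - y\<bar>, x + y] else []) seeds)))) = [1..21]"
  by code_simp

lemma seeds_diagonals_odd:
  "remdups_adj (sort (filter (\<lambda>v. 1 \<le> v \<and> v \<le> 75)
     (concat (map (\<lambda>(x, p, y, q). if p = q then [] else [\<bar>x - y\<bar>, x + y]) seeds)))) = [1..75]"
  by code_simp

lemma block_cover_seeds: "block_cover (set (symmetric_blocks seeds)) 48 75 21"
proof (rule block_cover_symmetric_blocks)
  have range: "0 \<le> x \<and> x \<le> 48 \<and> 0 \<le> y \<and> y \<le> 48 \<and> p \<in> {0, 1} \<and> q \<in> {0, 1}"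
    if "(x, p, y, q) \<in> set seeds" for x p y q
    using seeds_in_range that by (auto simp: list_all_iff)
  then show "0 \<le> x \<and> x \<le> 48 \<and> 0 \<le> y \<and> y \<le> 48 \<and> p \<in> {0, 1} \<and> q \<in> {0, 1}"
    if "(x, p, y, q) \<in> set seeds" for x p y q using that .
  show "\<exists>y q. (x, p, y, q) \<in> set seeds \<or> (y, q, x, p) \<in> set seeds"
    if "1 \<le> x" "x \<le> 48" "p \<in> {0, 1}" for x p :: int
  proof -
    have "2 * x + p \<in> set [2..97]" unfolding set_upto using that by auto
    then obtain x' p' y' q' where s: "(x', p', y', q') \<in> set seeds"
        "2 * x + p = 2 * x' + p' \<or> 2 * x + p = 2 * y' + q'"
      unfolding seeds_lines[symmetric] by auto
    have digits: "u = v \<and> a = b" if "2 * u + a = 2 * v + b" "a = 0 \<or> a = 1" "b = 0 \<or> b = 1" for u v a b :: int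
      using that by presburger
    have "(x' = x \<and> p' = p) \<or> (y' = x \<and> q' = p)"
      using s(2) digits[of x p x' p'] digits[of x p y' q'] range[OF s(1)] that(3) by auto
    with s(1) show ?thesis by blast
  qed
  show "\<exists>x p y q. (x, p, y, q) \<in> set seeds \<and> p = q \<and> (v = \<bar>x - y\<bar> \<or> v = x + y)"
    if "1 \<le> v" "v \<le> 21" for v :: int
  proof -
    have "v \<in> set [1..21]" unfolding set_upto using that by auto
    then show ?thesis unfolding seeds_diagonals_even[symmetric] by (fastforce split: if_splits)
  qed
  show "\<exists>x p y q. (x, p, y, q) \<in> set seeds \<and> p \<noteq> q \<and> (v = \<bar>x - y\<bar> \<or> v = x + y)"
    if "1 \<le> v" "v \<le> 75" for v :: int
  proof -
    have "v \<in> set [1..75]" unfolding set_upto using that by auto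
    then show ?thesis unfolding seeds_diagonals_odd[symmetric] by (fastforce split: if_splits)
  qed
qed simp_all

lemma card_symmetric_blocks_seeds: "card (set (symmetric_blocks seeds)) \<le> 199"
proof -
  have "length (concat (map quarter_turns xs)) = 4 * length xs" for xs
    by (induction xs) (auto simp: quarter_turns_def)
  then have "length (symmetric_blocks seeds) = 3 + 4 * length seeds"
    by (simp add: symmetric_blocks_def central_blocks_def)
  also have "length seeds = 49" by (simp add: seeds_def)
  finally have "length (symmetric_blocks seeds) = 199" by simp
  then show ?thesis by (metis card_length)
qed

section \<open>The upper bound\<close>

lemma queen_domination_progression:
  assumes "1 \<le> m"
  shows "queen_domination (2328 * m + 1565) \<le> 1198 * m + 1421"
proof -
  interpret block_blow_up "set (symmetric_blocks seeds)" 48 75 21 "int m"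
    using block_cover_seeds assms by (simp add: block_blow_up_def block_blow_up_axioms_def)
  have "nat (4 * reach + 1) = 2328 * m + 1565"
    by (simp add: reach_def spacing_def block_size_def)
  moreover have "card (set (symmetric_blocks seeds)) * nat (6 * int m + 7) + nat (4 * int m + 28) \<le> 1198 * m + 1421"
    using mult_right_mono[OF card_symmetric_blocks_seeds, of "nat (6 * int m + 7)"] by (simp add: nat_add_distrib nat_mult_distrib)
  ultimately show ?thesis
    using queen_domination_blow_up by simp
qed

theorem corollary3:
  shows "\<exists>C :: real. \<forall>N :: nat. N \<ge> 1 \<longrightarrow>
    real (domination_number (with_proj (queens_graph N))) \<le> 17 / 33 * real N + C"
proof (intro exI allI impI)
  fix N :: nat
  \<comment> \<open>The progression starts at side 3893 for \<open>m = 1\<close>. The constant 5314 is 1421, the one in the progression,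
    plus 3893, which exceeds the number of corner queens and bounds the small cases.\<close>
  show "real (queen_domination N) \<le> 17 / 33 * real N + 5314"
  proof (cases "3893 \<le> N")
    case True
    define m r where "m = (N - 1565) div 2328" and "r = (N - 1565) mod 2328"
    have N: "N = 2328 * m + 1565 + r" using True by (simp add: m_def r_def)
    have r: "r < 2328" by (simp add: r_def)
    have "1 \<le> m" using True by (simp add: m_def less_eq_div_iff_mult_less_eq)
    then have "queen_domination N \<le> 1198 * m + 1421 + r"
      using queen_domination_progression[of m] queen_domination_add[of "2328 * m + 1565" r] N by simp
    then have "real (queen_domination N) \<le> 1198 * real m + 1421 + real r" by linarith
    moreover have "real N = 2328 * real m + 1565 + real r" "real r < 2328" using N r by simp_all
    ultimately show ?thesis by linarith
  next
    case False
    have "dominating_set (with_proj (queens_graph 0)) {}"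
      by (simp add: dominating_set_queens_graph_iff chessboard_def)
    then have "queen_domination 0 \<le> 0" using domination_number_le[of "{}"] by fastforce
    then have "queen_domination N \<le> N" using queen_domination_add[of 0 N] by simp
    with False show ?thesis by simp
  qed
qed

end
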